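(* For $(p,q)\in\mathbf{N}$ and every integer $k\ge1$, $$\mu_k(\Lambda_{p,q}^* )=\sum_{k_1+k_2+k_3=k}\binom{k}{k_1,k_2,k_3}^2\left(1+2\sum_{j=1}^{\left\lfloor\frac{k_1}{p+q}\right\rfloor}\frac{\binom{2k_1-jq}{k_1+jp}\binom{k}{k_1-jq}}{\binom{k}{k_1}\binom{2(k-k_1)}{k-k_1}}\right),$$ where $k_1,k_2,k_3$ range over non-negative integers.
   Context: $\mathbb{N}_0=\{0,1,2,\ldots\}$ and $\mathbf{N}:=\{(p,q)\in\mathbb{N}_0^2 : p+q\ge 5,\ q\le p\}$. For such $(p,q)$, $\Lambda^*_{p,q}$ denotes the random eigenvalue of the dual infinite $(p,q)$-nanotube (the triangular lattice with a loop of weight $3$ at each vertex, rolled up along the chiral vector $(p,q)$), i.e. the real random variable with compactly supported distribution whose moments $\mu_k(\Lambda^*_{p,q})=\mathbb{E}(\Lambda^*_{p,q})^k$, $k\in\mathbb{N}_0$, are the (weighted) numbers of closed paths with $k$ steps from a vertex of this graph, given by $$\mu_k(\Lambda^*_{p,q})=\frac{1}{(2\pi)^3}\sum_{j\in\mathbb{Z}}\int_{-\pi}^{\pi}\int_{-\pi}^{\pi}\int_{-\pi}^{\pi}\left|e^{ix}+e^{iy}+e^{iz}\right|^{2k}e^{ij(p(x-z)+q(y-z))}\,dx\,dy\,dz .$$ For each fixed $k$ only finitely many terms of the sum are non-zero. Here $\binom{k}{k_1,k_2,k_3}=\frac{k!}{k_1!k_2!k_3!}$, and an empty sum is $0$.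 *)

theory Defs
  imports "HOL-Probability.Probability"
begin

text \<open>
  The sum over \<open>j\<close> has only finitely many non-zero terms for each \<open>k\<close>, so \<^const>\<open>infsum\<close> is
  a genuine finite sum here and not its default value \<open>0\<close>.
\<close>

definition dual_nanotube_moment :: "nat \<Rightarrow> nat \<Rightarrow> nat \<Rightarrow> complex" where
  "dual_nanotube_moment p q k =
     1 / (2 * complex_of_real pi) ^ 3 *
     (\<Sum>\<^sub>\<infinity>j\<in>(UNIV :: int set).
        integral {-pi..pi} (\<lambda>z. integral {-pi..pi} (\<lambda>y. integral {-pi..pi} (\<lambda>x.
          complex_of_real (cmod (cis x + cis y + cis z) ^ (2 * k)) *
          cis (of_int j * (real p * (x - z) + real q * (y - z)))))))"

text \<open>
  A real random variable on \<open>M\<close> is a version of the random eigenvalue of the dual infinite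
  \<open>(p,q)\<close>-nanotube if its distribution has compact support and it has the moments above. Being
  compactly supported, the distribution is determined by these moments.
\<close>

definition random_eigenvalue_dual_nanotube ::
    "'a measure \<Rightarrow> nat \<Rightarrow> nat \<Rightarrow> ('a \<Rightarrow> real) \<Rightarrow> bool" where
  "random_eigenvalue_dual_nanotube M p q X \<longleftrightarrow>
     prob_space M \<and> X \<in> borel_measurable M \<and>
     (\<exists>C. AE \<omega> in M. \<bar>X \<omega>\<bar> \<le> C) \<and>
     (\<forall>k. complex_of_real (prob_space.expectation M (\<lambda>\<omega>. X \<omega> ^ k)) = dual_nanotube_moment p q k)"

definition trinomial :: "nat \<Rightarrow> nat \<Rightarrow> nat \<Rightarrow> nat \<Rightarrow> real" where
  "trinomial k k1 k2 k3 = fact k / (fact k1 * fact k2 * fact k3)"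


subsection \<open>Existence of the random eigenvalue\<close>

lemma integral_cis_int:
  "((\<lambda>t. cis (of_int n * t)) has_integral (if n = 0 then 2 * complex_of_real pi else 0)) {-pi..pi}"
proof (cases "n = 0")
  case True
  then show ?thesis
    using has_integral_const_real[of "1::complex" "-pi" pi] by (simp add: scaleR_conv_of_real)
next
  case False
  define F where "F = (\<lambda>t. cis (of_int n * t) / (\<i> * of_int n))"
  have "(F has_vector_derivative cis (of_int n * t)) (at t within {-pi..pi})" for t
  proof -
    have "((\<lambda>t. exp (\<i> * of_int n * complex_of_real t) / (\<i> * of_int n)) has_vector_derivative
            exp (\<i> * of_int n * complex_of_real t)) (at t within {-pi..pi})"
      by (rule has_vector_derivative_real_field)
         (use False in \<open>auto intro!: derivative_eq_intros\<close>)
    then show ?thesis by (simp add: F_def cis_conv_exp mult.assoc)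
  qed
  then have "((\<lambda>t. cis (of_int n * t)) has_integral (F pi - F (-pi))) {-pi..pi}"
    by (intro fundamental_theorem_of_calculus) auto
  moreover have "F pi = F (-pi)"
  proof -
    have "of_int n * pi = of_int n * (-pi) + 2 * pi * of_int n"
      by (simp add: algebra_simps)
    then have "cis (of_int n * pi) = cis (of_int n * (-pi)) * cis (2 * pi * of_int n)"
      by (simp only: cis_mult)
    also have "\<dots> = cis (of_int n * (-pi))"
      by (subst cis_multiple_2pi) auto
    finally show ?thesis by (simp add: F_def)
  qed
  ultimately show ?thesis using False by simp
qed

lemma integral3_cis:
  "integral {-pi..pi} (\<lambda>z. integral {-pi..pi} (\<lambda>y. integral {-pi..pi} (\<lambda>x.
      cis (of_int a * x) * (cis (of_int b * y) * cis (of_int c * z)))))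
   = (if a = 0 \<and> b = 0 \<and> c = 0 then (2 * complex_of_real pi) ^ 3 else 0)"
proof -
  have "integral {-pi..pi} (\<lambda>t. cis (of_int n * t)) = (if n = 0 then 2 * complex_of_real pi else 0)"
    for n using integral_cis_int by (rule integral_unique)
  then show ?thesis by (simp add: power3_eq_cube)
qed

lemma cmod_power_expansion:
  "\<exists>L :: (int \<times> int) list. \<forall>x y z.
     complex_of_real (cmod (cis x + cis y + cis z) ^ (2 * k)) =
     (\<Sum>(m, l)\<leftarrow>L. cis (of_int m * (x - z) + of_int l * (y - z)))"
proof (induction k)
  case 0
  show ?case by (rule exI[of _ "[(0, 0)]"]) simp
next
  case (Suc k)
  then obtain L :: "(int \<times> int) list" where L: "\<And>x y z.
     complex_of_real (cmod (cis x + cis y + cis z) ^ (2 * k)) =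
     (\<Sum>(m, l)\<leftarrow>L. cis (of_int m * (x - z) + of_int l * (y - z)))" by blast
  define D :: "(int \<times> int) list" where
    "D = [(0,0), (0,0), (0,0), (1,0), (-1,0), (0,1), (0,-1), (1,-1), (-1,1)]"
  define L' where "L' = concat (map (\<lambda>d. map (\<lambda>v. (fst d + fst v, snd d + snd v)) L) D)"
  have sq: "complex_of_real ((cmod (cis x + cis y + cis z))\<^sup>2) =
      (\<Sum>(m, l)\<leftarrow>D. cis (of_int m * (x - z) + of_int l * (y - z)))" for x y z
  proof -
    have "complex_of_real ((cmod (cis x + cis y + cis z))\<^sup>2) =
        (cis x + cis y + cis z) * (cis (-x) + cis (-y) + cis (-z))"
      unfolding complex_norm_square by (simp add: cis_cnj)
    then show ?thesis
      by (simp add: D_def cis_mult algebra_simps)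
  qed
  have mul: "sum_list (map (\<lambda>(m, l). cis (of_int m * a + of_int l * b)) D1) *
        sum_list (map (\<lambda>(m, l). cis (of_int m * a + of_int l * b)) L) =
      (\<Sum>(m, l)\<leftarrow>concat (map (\<lambda>d. map (\<lambda>v. (fst d + fst v, snd d + snd v)) L) D1).
         cis (of_int m * a + of_int l * b))" for a b and D1 :: "(int \<times> int) list"
  proof (induction D1)
    case Nil
    show ?case by simp
  next
    case (Cons d D1)
    have "(\<Sum>(m, l)\<leftarrow>map (\<lambda>v. (fst d + fst v, snd d + snd v)) L. cis (of_int m * a + of_int l * b)) =
      cis (of_int (fst d) * a + of_int (snd d) * b) *
        sum_list (map (\<lambda>(m, l). cis (of_int m * a + of_int l * b)) L)"
      by (induction L) (auto simp: cis_mult algebra_simps)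
    with Cons show ?case by (auto simp: algebra_simps split: prod.splits)
  qed
  show ?case
  proof (rule exI[of _ L'], intro allI)
    fix x y z
    have "complex_of_real (cmod (cis x + cis y + cis z) ^ (2 * Suc k)) =
       complex_of_real ((cmod (cis x + cis y + cis z))\<^sup>2) *
       complex_of_real (cmod (cis x + cis y + cis z) ^ (2 * k))"
      by (simp add: power2_eq_square)
    also have "\<dots> = (\<Sum>(m, l)\<leftarrow>L'. cis (of_int m * (x - z) + of_int l * (y - z)))"
      unfolding sq L L'_def by (rule mul)
    finally show "complex_of_real (cmod (cis x + cis y + cis z) ^ (2 * Suc k)) =
      (\<Sum>(m, l)\<leftarrow>L'. cis (of_int m * (x - z) + of_int l * (y - z)))" .
  qed
qed

lemma integral3_sum_list:
  fixes f :: "'c \<Rightarrow> real \<Rightarrow> real \<Rightarrow> real \<Rightarrow> complex"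
  assumes f: "\<And>v x y z. f v x y z = g v x * (h v y * w v z)"
  assumes cont: "\<And>v. continuous_on {-pi..pi} (g v)" "\<And>v. continuous_on {-pi..pi} (h v)"
    "\<And>v. continuous_on {-pi..pi} (w v)"
  shows "integral {-pi..pi} (\<lambda>z. integral {-pi..pi} (\<lambda>y. integral {-pi..pi} (\<lambda>x. \<Sum>v\<leftarrow>L. f v x y z))) =
   (\<Sum>v\<leftarrow>L. integral {-pi..pi} (\<lambda>z. integral {-pi..pi} (\<lambda>y. integral {-pi..pi} (\<lambda>x. f v x y z))))"
proof -
  have int: "g v integrable_on {-pi..pi}" "h v integrable_on {-pi..pi}" "w v integrable_on {-pi..pi}"
    for v using cont by (auto intro: integrable_continuous_interval)
  have 1: "integral {-pi..pi} (\<lambda>x. \<Sum>v\<leftarrow>L. g v x * (h v y * w v z)) =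
      (\<Sum>v\<leftarrow>L. integral {-pi..pi} (g v) * (h v y * w v z)) \<and>
      (\<lambda>x. \<Sum>v\<leftarrow>L. g v x * (h v y * w v z)) integrable_on {-pi..pi}" for y z
    by (induction L)
       (auto simp: Henstock_Kurzweil_Integration.integral_add int
             integrable_on_mult_left integrable_on_mult_right
             intro!: integrable_add integrable_on_mult_left)
  have 2: "integral {-pi..pi} (\<lambda>y. \<Sum>v\<leftarrow>L. integral {-pi..pi} (g v) * (h v y * w v z)) =
      (\<Sum>v\<leftarrow>L. integral {-pi..pi} (g v) * (integral {-pi..pi} (h v) * w v z)) \<and>
      (\<lambda>y. \<Sum>v\<leftarrow>L. integral {-pi..pi} (g v) * (h v y * w v z)) integrable_on {-pi..pi}" for z
    by (induction L)
       (auto simp: Henstock_Kurzweil_Integration.integral_add int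
             integrable_on_mult_left integrable_on_mult_right
             intro!: integrable_add integrable_on_mult_left integrable_on_mult_right)
  have 3: "integral {-pi..pi} (\<lambda>z. \<Sum>v\<leftarrow>L. integral {-pi..pi} (g v) * (integral {-pi..pi} (h v) * w v z)) =
      (\<Sum>v\<leftarrow>L. integral {-pi..pi} (g v) * (integral {-pi..pi} (h v) * integral {-pi..pi} (w v))) \<and>
      (\<lambda>z. \<Sum>v\<leftarrow>L. integral {-pi..pi} (g v) * (integral {-pi..pi} (h v) * w v z)) integrable_on {-pi..pi}"
    by (induction L)
       (auto simp: Henstock_Kurzweil_Integration.integral_add int
             integrable_on_mult_left integrable_on_mult_right
             intro!: integrable_add integrable_on_mult_left integrable_on_mult_right)
  show ?thesis using 1 2 3 by (simp add: f)
qed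

lemma dual_nanotube_moment_expansion:
  fixes L :: "(int \<times> int) list"
  assumes L: "\<And>x y z. complex_of_real (cmod (cis x + cis y + cis z) ^ (2 * k)) =
     (\<Sum>(m, l)\<leftarrow>L. cis (of_int m * (x - z) + of_int l * (y - z)))"
    and p: "p > 0"
  shows "dual_nanotube_moment p q k =
     (\<Sum>(m, l)\<leftarrow>L. if \<exists>s. m = s * int p \<and> l = s * int q then 1 else 0)"
proof -
  define G where "G = (\<lambda>(j::int) (v::int \<times> int) x y z.
      cis (of_int (fst v) * (x - z) + of_int (snd v) * (y - z)) *
      cis (of_int j * (real p * (x - z) + real q * (y - z))))"
  have G: "G j v x y z = cis (of_int (fst v + j * int p) * x) *
     (cis (of_int (snd v + j * int q) * y) *
      cis (of_int (- (fst v + j * int p) - (snd v + j * int q)) * z))" for j v x y z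
    by (simp add: G_def cis_mult algebra_simps)
  have I: "integral {-pi..pi} (\<lambda>z. integral {-pi..pi} (\<lambda>y. integral {-pi..pi} (\<lambda>x. G j v x y z))) =
      (if fst v + j * int p = 0 \<and> snd v + j * int q = 0 then (2 * complex_of_real pi) ^ 3 else 0)" for j v
    unfolding G by (subst integral3_cis) auto
  have J: "integral {-pi..pi} (\<lambda>z. integral {-pi..pi} (\<lambda>y. integral {-pi..pi} (\<lambda>x.
          complex_of_real (cmod (cis x + cis y + cis z) ^ (2 * k)) *
          cis (of_int j * (real p * (x - z) + real q * (y - z)))))) =
     (\<Sum>v\<leftarrow>L. if fst v + j * int p = 0 \<and> snd v + j * int q = 0 then (2 * complex_of_real pi) ^ 3 else 0)" for j
  proof -
    have "complex_of_real (cmod (cis x + cis y + cis z) ^ (2 * k)) *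
          cis (of_int j * (real p * (x - z) + real q * (y - z))) = (\<Sum>v\<leftarrow>L. G j v x y z)" for x y z
      unfolding L by (simp add: G_def sum_list_mult_const [symmetric] case_prod_unfold)
    then show ?thesis
      by (simp add: I [symmetric])
         (rule integral3_sum_list[OF G]; intro continuous_intros)
  qed
  have S: "((\<lambda>j. \<Sum>v\<leftarrow>L. if fst v + j * int p = 0 \<and> snd v + j * int q = 0 then (2 * complex_of_real pi) ^ 3 else 0)
      has_sum (\<Sum>v\<leftarrow>L. if \<exists>s. fst v = s * int p \<and> snd v = s * int q then (2 * complex_of_real pi) ^ 3 else 0)) UNIV"
  proof (induction L)
    case Nil
    show ?case by simp
  next
    case (Cons v L)
    have "((\<lambda>j. if fst v + j * int p = 0 \<and> snd v + j * int q = 0 then (2 * complex_of_real pi) ^ 3 else 0)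
      has_sum (if \<exists>s. fst v = s * int p \<and> snd v = s * int q then (2 * complex_of_real pi) ^ 3 else 0)) UNIV"
    proof (cases "\<exists>s. fst v = s * int p \<and> snd v = s * int q")
      case True
      then obtain s where s: "fst v = s * int p" "snd v = s * int q" by blast
      have "fst v + j * int p = 0 \<and> snd v + j * int q = 0 \<longleftrightarrow> j = -s" for j
      proof -
        have "fst v + j * int p = (s + j) * int p" "snd v + j * int q = (s + j) * int q"
          by (simp_all add: s algebra_simps)
        then show ?thesis using p by auto
      qed
      then have "(\<lambda>j. if fst v + j * int p = 0 \<and> snd v + j * int q = 0 then (2 * complex_of_real pi) ^ 3 else 0)
        = (\<lambda>j. if j = -s then (2 * complex_of_real pi) ^ 3 else 0)" by presburger
      moreover have "((\<lambda>j. if j = -s then (2 * complex_of_real pi) ^ 3 else 0) has_sum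
          (2 * complex_of_real pi) ^ 3) (UNIV :: int set)"
        by (rule has_sum_finite_neutralI[of "{-s}"]) auto
      ultimately show ?thesis using True by simp
    next
      case False
      have "\<not> (fst v + j * int p = 0 \<and> snd v + j * int q = 0)" for j
      proof
        assume "fst v + j * int p = 0 \<and> snd v + j * int q = 0"
        then have "fst v = (-j) * int p \<and> snd v = (-j) * int q" by (simp add: algebra_simps)
        with False show False by blast
      qed
      then have "(\<lambda>j. if fst v + j * int p = 0 \<and> snd v + j * int q = 0 then (2 * complex_of_real pi) ^ 3 else 0)
        = (\<lambda>j. 0)" by (intro ext) (simp only: if_False)
      then show ?thesis using False by (simp only: if_False has_sum_0)
    qed
    from has_sum_add[OF this Cons] show ?case by simp
  qed
  have "dual_nanotube_moment p q k = 1 / (2 * complex_of_real pi) ^ 3 *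
     (\<Sum>v\<leftarrow>L. if \<exists>s. fst v = s * int p \<and> snd v = s * int q then (2 * complex_of_real pi) ^ 3 else 0)"
    unfolding dual_nanotube_moment_def J using infsumI[OF S] by simp
  also have "\<dots> = (\<Sum>v\<leftarrow>L. if \<exists>s. fst v = s * int p \<and> snd v = s * int q then 1 else 0)"
    by (auto simp: sum_list_const_mult [symmetric] intro!: arg_cong[of _ _ sum_list] map_cong)
  finally show ?thesis by (simp add: case_prod_unfold)
qed

lemma sum_cis_roots:
  assumes p: "p > (0::nat)"
  shows "(\<Sum>n<p. cis (2 * pi * of_int m * real n / real p)) = (if int p dvd m then of_nat p else 0)"
proof (cases "int p dvd m")
  case True
  then obtain s where s: "m = int p * s" by blast
  have "cis (2 * pi * of_int m * real n / real p) = 1" for n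
  proof -
    have "2 * pi * of_int m * real n / real p = 2 * pi * of_int (s * int n)"
      using p by (simp add: s)
    then show ?thesis by (simp only: cis_multiple_2pi Ints_of_int)
  qed
  then show ?thesis using True by simp
next
  case False
  define w where "w = cis (2 * pi * of_int m / real p)"
  have wn: "cis (2 * pi * of_int m * real n / real p) = w ^ n" for n
    unfolding w_def Complex.DeMoivre by (rule arg_cong[of _ _ cis]) simp
  have "w ^ p = 1"
    using p by (simp add: w_def Complex.DeMoivre cis_multiple_2pi)
  moreover have "w \<noteq> 1"
  proof
    assume "w = 1"
    then have "cos (2 * pi * of_int m / real p) = 1"
      by (simp add: w_def complex_eq_iff)
    then obtain s :: int where "2 * pi * of_int m / real p = of_int s * 2 * pi"
      by (subst (asm) cos_one_2pi_int) auto
    then have "real_of_int m = of_int (s * int p)" using p by (simp add: field_simps)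
    then have "m = s * int p" by (simp only: of_int_eq_iff)
    with False show False by simp
  qed
  ultimately show ?thesis using False by (simp add: wn sum_gp_strict)
qed

lemma random_eigenvalue_dual_nanotube_exists:
  assumes "p + q \<ge> 5" "q \<le> p"
  shows "\<exists>(M :: (nat \<times> real) measure) X. random_eigenvalue_dual_nanotube M p q X"
proof -
  from assms have p: "p > 0" by linarith
  define U where "U = density lborel (\<lambda>t. ennreal (indicator {-pi..pi} t / (2 * pi)))"
  define N where "N = measure_pmf (pmf_of_set {..<p})"
  define M where "M = N \<Otimes>\<^sub>M U"
  have "emeasure U (space U) = 1"
  proof -
    have "emeasure U (space U) = (\<integral>\<^sup>+t. ennreal (1 / (2 * pi)) * indicator {-pi..pi} t \<partial>lborel)"
      by (auto simp: U_def emeasure_density intro!: nn_integral_cong split: split_indicator)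
    also have "\<dots> = ennreal (1 / (2 * pi)) * ennreal (2 * pi)"
      by (subst nn_integral_cmult_indicator) auto
    also have "\<dots> = 1" by (subst ennreal_mult [symmetric]) auto
    finally show ?thesis .
  qed
  then interpret U: prob_space U by (rule prob_spaceI)
  interpret N: prob_space N unfolding N_def by (rule measure_pmf.prob_space_axioms)
  interpret pair_prob_space N U ..
  have setsU [measurable_cong]: "sets U = sets borel" by (simp add: U_def)
  have setsN [measurable_cong]: "sets N = sets (count_space UNIV)" by (simp add: N_def)
  have prM: "prob_space M" unfolding M_def by (rule prob_space_axioms)
  then interpret M: prob_space M .
  have Uint: "(\<integral>t. cis (of_int c * t) \<partial>U) = (if c = 0 then 1 else 0)" for c
  proof -
    have "(\<integral>t. cis (of_int c * t) \<partial>U) =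
        (\<integral>t. (indicator {-pi..pi} t / (2 * pi)) *\<^sub>R cis (of_int c * t) \<partial>lborel)"
      unfolding U_def by (rule integral_density) (auto intro!: borel_measurable_continuous_onI continuous_intros)
    also have "\<dots> = (\<integral>t. (1 / (2 * pi)) *\<^sub>R (indicator {-pi..pi} t *\<^sub>R cis (of_int c * t)) \<partial>lborel)"
      by (rule Bochner_Integration.integral_cong) auto
    also have "\<dots> = (1 / (2 * pi)) *\<^sub>R (LINT t:{-pi..pi}|lborel. cis (of_int c * t))"
      by (simp only: set_lebesgue_integral_def integral_scaleR_right)
    also have "(LINT t:{-pi..pi}|lborel. cis (of_int c * t)) = integral {-pi..pi} (\<lambda>t. cis (of_int c * t))"
      by (intro set_borel_integral_eq_integral borel_integrable_atLeastAtMost' continuous_intros)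
    also have "\<dots> = (if c = 0 then 2 * complex_of_real pi else 0)"
      using integral_cis_int by (rule integral_unique)
    finally show ?thesis by (simp add: scaleR_conv_of_real)
  qed
  define a where "a = (\<lambda>(n::nat, t::real). (2 * pi * real n - real q * t) / real p)"
  define X where "X = (\<lambda>\<omega>. (cmod (cis (a \<omega>) + cis (snd \<omega>) + cis 0))\<^sup>2)"
  have cis_meas [measurable]: "cis \<in> borel_measurable borel"
    by (intro borel_measurable_continuous_onI continuous_intros)
  have snd_meas [measurable]: "(snd :: nat \<times> real \<Rightarrow> real) \<in> borel_measurable M"
    unfolding M_def by measurable
  have a_meas [measurable]: "a \<in> borel_measurable M"
    unfolding a_def M_def by measurable
  have X_meas [measurable]: "X \<in> borel_measurable M"
    unfolding X_def by measurable
  have term_meas: "(\<lambda>\<omega>. cis (of_int m * a \<omega> + of_int l * snd \<omega>)) \<in> borel_measurable M" for m l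
    by measurable
  have int: "integrable M (\<lambda>\<omega>. cis (of_int m * a \<omega> + of_int l * snd \<omega>))" for m l
    by (rule M.integrable_const_bound[of _ 1]) (use term_meas in auto)
  have E: "(\<integral>\<omega>. cis (of_int m * a \<omega> + of_int l * snd \<omega>) \<partial>M) =
      (if \<exists>s. m = s * int p \<and> l = s * int q then 1 else 0)" for m l
  proof -
    define r where "r = real_of_int l - of_int m * real q / real p"
    have split: "cis (of_int m * a (n, t) + of_int l * t) =
        cis (2 * pi * of_int m * real n / real p) * cis (r * t)" for n t
      using p by (simp add: a_def r_def cis_mult field_simps)
    have "(\<integral>\<omega>. cis (of_int m * a \<omega> + of_int l * snd \<omega>) \<partial>M) =
        (\<integral>n. (\<integral>t. cis (of_int m * a (n, t) + of_int l * t) \<partial>U) \<partial>N)"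
      using integral_fst'[OF int[of m l, unfolded M_def]] by (simp add: M_def)
    also have "\<dots> = (\<integral>n. cis (2 * pi * of_int m * real n / real p) * (\<integral>t. cis (r * t) \<partial>U) \<partial>N)"
      unfolding split by simp
    also have "\<dots> = (\<Sum>n<p. cis (2 * pi * of_int m * real n / real p) * (\<integral>t. cis (r * t) \<partial>U)) / of_nat p"
      unfolding N_def using p
      by (subst integral_measure_pmf[of "{..<p}"])
         (auto simp: lessThan_empty_iff pmf_of_set scaleR_conv_of_real sum_divide_distrib)
    also have "\<dots> = (if int p dvd m then 1 else 0) * (\<integral>t. cis (r * t) \<partial>U)"
      using p by (simp add: sum_distrib_right [symmetric] sum_cis_roots)
    also have "\<dots> = (if \<exists>s. m = s * int p \<and> l = s * int q then 1 else 0)"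
    proof (cases "int p dvd m")
      case True
      then obtain s where s: "m = int p * s" by blast
      have "r = of_int (l - s * int q)" using p by (simp add: r_def s)
      then have "(\<integral>t. cis (r * t) \<partial>U) = (if l - s * int q = 0 then 1 else 0)"
        by (simp only: Uint)
      moreover have "(\<exists>s. m = s * int p \<and> l = s * int q) \<longleftrightarrow> l = s * int q"
        using p by (auto simp: s)
      ultimately show ?thesis using True by simp
    next
      case False
      then have "\<nexists>s. m = s * int p \<and> l = s * int q" by auto
      with False show ?thesis by simp
    qed
    finally show ?thesis .
  qed
  have "complex_of_real (\<integral>\<omega>. X \<omega> ^ k \<partial>M) = dual_nanotube_moment p q k" for k
  proof -
    obtain L :: "(int \<times> int) list" where L: "\<And>x y z.
       complex_of_real (cmod (cis x + cis y + cis z) ^ (2 * k)) =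
       (\<Sum>(m, l)\<leftarrow>L. cis (of_int m * (x - z) + of_int l * (y - z)))"
      using cmod_power_expansion[of k] by blast
    have "complex_of_real (\<integral>\<omega>. X \<omega> ^ k \<partial>M) = (\<integral>\<omega>. complex_of_real (X \<omega> ^ k) \<partial>M)"
      by (rule integral_complex_of_real [symmetric])
    also have "\<dots> = (\<integral>\<omega>. (\<Sum>(m, l)\<leftarrow>L. cis (of_int m * a \<omega> + of_int l * snd \<omega>)) \<partial>M)"
      unfolding X_def power_mult [symmetric] L by simp
    also have "\<dots> = (\<Sum>(m, l)\<leftarrow>L. \<integral>\<omega>. cis (of_int m * a \<omega> + of_int l * snd \<omega>) \<partial>M)"
    proof -
      have "integrable M (\<lambda>\<omega>. \<Sum>(m, l)\<leftarrow>L. cis (of_int m * a \<omega> + of_int l * snd \<omega>)) \<and>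
        (\<integral>\<omega>. (\<Sum>(m, l)\<leftarrow>L. cis (of_int m * a \<omega> + of_int l * snd \<omega>)) \<partial>M) =
        (\<Sum>(m, l)\<leftarrow>L. \<integral>\<omega>. cis (of_int m * a \<omega> + of_int l * snd \<omega>) \<partial>M)"
        by (induction L) (auto simp: int)
      then show ?thesis by blast
    qed
    also have "\<dots> = dual_nanotube_moment p q k"
      unfolding E dual_nanotube_moment_expansion[OF L p] by simp
    finally show ?thesis .
  qed
  moreover have "\<bar>X \<omega>\<bar> \<le> 9" for \<omega>
  proof -
    have "cmod (cis (a \<omega>) + cis (snd \<omega>) + cis 0) \<le> 3"
      by (intro norm_triangle_le order_trans[OF add_mono[OF norm_triangle_ineq order_refl]]) simp
    then have "(cmod (cis (a \<omega>) + cis (snd \<omega>) + cis 0))\<^sup>2 \<le> 3\<^sup>2"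
      by (intro power_mono) auto
    then show ?thesis by (simp add: X_def)
  qed
  ultimately have "random_eigenvalue_dual_nanotube M p q X"
    unfolding random_eigenvalue_dual_nanotube_def using prM X_meas by blast
  then show ?thesis by blast
qed

end

theory Submission
  imports Defs
begin

text \<open>
  Expanding \<open>\<bar>e\<^sup>i\<^sup>x + e\<^sup>i\<^sup>y + e\<^sup>i\<^sup>z\<bar>\<^sup>2\<^sup>k\<close> by the trinomial theorem, the \<open>j\<close>-th integral is the correlation
  of the trinomial coefficients with their translate by \<open>(jp, jq, -j(p + q))\<close>. The terms \<open>j\<close>
  and \<open>-j\<close> agree. Summing over the first exponent with the second one, \<open>k - k\<^sub>1\<close>, fixed is a
  Vandermonde convolution and leaves the single sum over \<open>k\<^sub>1\<close>; the sum over \<open>k\<^sub>2 + k\<^sub>3 = k - k\<^sub>1\<close>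
  in the statement is another one, whose value is cancelled by the denominator.
\<close>

section \<open>Trinomial expansion of the integrand and of the moments\<close>

text \<open>The list in \<open>dual_nanotube_moment_expansion\<close> carries frequencies without
  coefficients, so integer coefficients are encoded as multiplicities of entries.\<close>

lemma sum_list_concat_replicate:
  fixes f :: "'b \<Rightarrow> 'c::comm_semiring_1"
  shows "(\<Sum>v\<leftarrow>concat (map (\<lambda>t. replicate (n t) (g t)) ts). f v) = (\<Sum>t\<leftarrow>ts. of_nat (n t) * f (g t))"
  by (induction ts) (simp_all add: sum_list_replicate)

text \<open>The exponent \<open>b\<close> of the middle variable is chosen first, because it is the
  sum over \<open>a\<close> at fixed \<open>b\<close> that Vandermonde evaluates later.\<close>

lemma trinomial_expansion:
  fixes u v w :: "'a::comm_semiring_1"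
  shows "(u + v + w) ^ k =
    (\<Sum>(b, a)\<in>(SIGMA b:{..k}. {..k - b}).
       of_nat ((k choose b) * ((k - b) choose a)) * (u ^ a * v ^ b * w ^ (k - b - a)))"
proof -
  have "(u + v + w) ^ k = (v + (u + w)) ^ k"
    by (simp add: add_ac)
  also have "\<dots> = (\<Sum>b\<le>k. of_nat (k choose b) * v ^ b * (u + w) ^ (k - b))"
    by (rule binomial_ring)
  also have "\<dots> = (\<Sum>b\<le>k. \<Sum>a\<le>k - b.
      of_nat ((k choose b) * ((k - b) choose a)) * (u ^ a * v ^ b * w ^ (k - b - a)))"
    unfolding binomial_ring[of u] sum_distrib_left by (simp add: mult_ac)
  also have "\<dots> = (\<Sum>(b, a)\<in>(SIGMA b:{..k}. {..k - b}).
       of_nat ((k choose b) * ((k - b) choose a)) * (u ^ a * v ^ b * w ^ (k - b - a)))"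
    by (rule sum.Sigma) auto
  finally show ?thesis .
qed

lemma cmod_power_trinomial:
  fixes k :: nat
  defines "A \<equiv> (SIGMA b:{..k}. {..k - b})"
    and "W \<equiv> (\<lambda>(b, a). (k choose b) * ((k - b) choose a))"
  shows "complex_of_real (cmod (cis x + cis y + cis z) ^ (2 * k)) =
    (\<Sum>(t, t')\<in>A \<times> A. of_nat (W t * W t') *
       cis (of_int (int (snd t') - int (snd t)) * (x - z) +
            of_int (int (fst t') - int (fst t)) * (y - z)))"
proof -
  \<comment> \<open>All monomials have degree \<open>k\<close>, so in terms of \<open>x - z\<close>
    and \<open>y - z\<close> the phases share the summand \<open>real k * z\<close>. It cancels
    against that of the conjugate power.\<close>
  have pow: "(cis x + cis y + cis z) ^ k =
      (\<Sum>t\<in>A. of_nat (W t) * cis (real (snd t) * (x - z) + real (fst t) * (y - z) + real k * z))"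
    for x y z
    unfolding trinomial_expansion A_def W_def
    by (intro sum.cong) (auto simp: Complex.DeMoivre cis_mult of_nat_diff algebra_simps)
  have "complex_of_real (cmod (cis x + cis y + cis z) ^ (2 * k)) =
      (cis x + cis y + cis z) ^ k * (cis (-x) + cis (-y) + cis (-z)) ^ k"
    unfolding power_mult power_mult_distrib[symmetric] of_real_power
    by (subst complex_norm_square[symmetric, unfolded of_real_power, symmetric])
       (simp add: cis_cnj)
  also have "\<dots> = (\<Sum>t'\<in>A. \<Sum>t\<in>A. of_nat (W t * W t') *
       cis (of_int (int (snd t') - int (snd t)) * (x - z) +
            of_int (int (fst t') - int (fst t)) * (y - z)))"
    unfolding pow sum_product
    by (intro sum.cong refl) (simp add: cis_mult algebra_simps)
  also have "\<dots> = (\<Sum>t\<in>A. \<Sum>t'\<in>A. of_nat (W t * W t') *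
       cis (of_int (int (snd t') - int (snd t)) * (x - z) +
            of_int (int (fst t') - int (fst t)) * (y - z)))"
    by (rule sum.swap)
  finally show ?thesis by (simp add: sum.cartesian_product)
qed

text \<open>Orthogonality of characters keeps the pairs of exponent vectors whose difference is a
  multiple of the chiral vector. The x-exponent is \<open>snd\<close>, going with \<open>p\<close>,
  and the y-exponent is \<open>fst\<close>, going with \<open>q\<close>; the z-exponent is fixed by
  the common degree \<open>k\<close>.\<close>

lemma dual_nanotube_moment_pairs:
  fixes k p q :: nat
  defines "A \<equiv> (SIGMA b:{..k}. {..k - b})"
    and "W \<equiv> (\<lambda>(b, a). (k choose b) * ((k - b) choose a))"
  assumes "p > 0"
  shows "dual_nanotube_moment p q k =
    of_nat (\<Sum>(t, t')\<in>A \<times> A. W t * W t' *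
       of_bool (\<exists>s. int (snd t') - int (snd t) = s * int p \<and> int (fst t') - int (fst t) = s * int q))"
proof -
  have "finite (A \<times> A)" by (simp add: A_def)
  then obtain ts where ts: "set ts = A \<times> A" "distinct ts"
    using finite_distinct_list by blast
  define n where "n = (\<lambda>(t, t'). W t * W t')"
  define g where "g = (\<lambda>(t, t'). (int (snd t') - int (snd t), int (fst t') - int (fst t)))"
  define L where "L = concat (map (\<lambda>t. replicate (n t) (g t)) ts)"
  have sumL: "(\<Sum>v\<leftarrow>L. f v) = (\<Sum>t\<in>A \<times> A. of_nat (n t) * f (g t))" for f :: "_ \<Rightarrow> complex"
    unfolding L_def sum_list_concat_replicate
    using ts by (simp add: sum_list_distinct_conv_sum_set)
  have "dual_nanotube_moment p q k =
      (\<Sum>(m, l)\<leftarrow>L. if \<exists>s. m = s * int p \<and> l = s * int q then 1 else 0)"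
  proof (rule dual_nanotube_moment_expansion[OF _ \<open>p > 0\<close>])
    show "complex_of_real (cmod (cis x + cis y + cis z) ^ (2 * k)) =
        (\<Sum>(m, l)\<leftarrow>L. cis (of_int m * (x - z) + of_int l * (y - z)))" for x y z
      unfolding sumL cmod_power_trinomial A_def W_def n_def g_def
      by (simp add: case_prod_unfold)
  qed
  then show ?thesis
    unfolding sumL by (simp add: n_def g_def case_prod_unfold of_bool_def if_distrib[of of_nat] cong: if_cong)
qed

section \<open>Vandermonde convolution for shifted coefficients\<close>

text \<open>Reflecting \<open>a\<close> to \<open>n - a\<close> gives Vandermonde's convolution for
  \<open>n\<close> and \<open>n - Q\<close> at \<open>n + P\<close>. With \<open>Q \<le> n\<close>
  the two sizes add up to \<open>2 * n - Q\<close> despite truncated subtraction.\<close>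

lemma vandermonde_shift:
  fixes n P Q :: nat
  assumes "Q \<le> n"
  shows "(\<Sum>a\<le>n. (n choose a) * ((n - Q) choose (a + P))) = (2 * n - Q) choose (n + P)"
proof -
  have "(2 * n - Q) choose (n + P) = (\<Sum>i\<le>n + P. (n choose i) * ((n - Q) choose (n + P - i)))"
    using vandermonde[of n "n - Q" "n + P"] assms by (simp add: mult_2)
  also have "\<dots> = (\<Sum>i\<le>n. (n choose i) * ((n - Q) choose (n + P - i)))"
    by (rule sum.mono_neutral_right) auto
  also have "\<dots> = (\<Sum>a\<le>n. (n choose a) * ((n - Q) choose (a + P)))"
    by (rule sum.reindex_bij_witness[of _ "\<lambda>i. n - i" "\<lambda>i. n - i"])
       (auto simp: binomial_symmetric[symmetric])
  finally show ?thesis ..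
qed

text \<open>Put \<open>n = k - b\<close>. The binomials containing only \<open>b\<close> leave the
  sum over \<open>a\<close>, which is then \<open>vandermonde_shift\<close>.\<close>

lemma trinomial_correlation:
  fixes k P Q :: nat
  shows "(\<Sum>(b, a)\<in>(SIGMA b:{..k}. {..k - b}).
      (k choose b) * ((k - b) choose a) * ((k choose (b + Q)) * ((k - (b + Q)) choose (a + P)))) =
    (\<Sum>n\<le>k. of_bool (Q \<le> n) * ((k choose n) * (k choose (n - Q)) * ((2 * n - Q) choose (n + P))))"
proof -
  have inner: "(\<Sum>a\<le>n. (k choose (k - n)) * (n choose a) *
        ((k choose (k - n + Q)) * ((k - (k - n + Q)) choose (a + P)))) =
      of_bool (Q \<le> n) * ((k choose n) * (k choose (n - Q)) * ((2 * n - Q) choose (n + P)))"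
    if n: "n \<le> k" for n
  proof (cases "Q \<le> n")
    case True
    then have eq: "k - (k - n + Q) = n - Q" "k choose (k - n + Q) = k choose (n - Q)"
      using n binomial_symmetric[of "k - n + Q" k] by auto
    have "(k choose (k - n)) * (n choose a) * ((k choose (n - Q)) * ((n - Q) choose (a + P))) =
        (k choose n) * (k choose (n - Q)) * ((n choose a) * ((n - Q) choose (a + P)))" for a
      using binomial_symmetric[OF n] by (simp add: mult_ac)
    then show ?thesis
      using True by (simp only: eq vandermonde_shift flip: sum_distrib_left) simp
  next
    case False
    \<comment> \<open>The shifted exponent exceeds \<open>k\<close>, so the left side is 0, whereas
      truncation would turn \<open>k choose (n - Q)\<close> into 1; hence the guard
      \<open>of_bool (Q \<le> n)\<close>.\<close>
    then have "k < k - n + Q" using n by linarith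
    then show ?thesis using False by (simp add: binomial_eq_0)
  qed
  have "(\<Sum>(b, a)\<in>(SIGMA b:{..k}. {..k - b}).
      (k choose b) * ((k - b) choose a) * ((k choose (b + Q)) * ((k - (b + Q)) choose (a + P)))) =
    (\<Sum>b\<le>k. \<Sum>a\<le>k - b.
      (k choose b) * ((k - b) choose a) * ((k choose (b + Q)) * ((k - (b + Q)) choose (a + P))))"
    by (rule sum.Sigma[symmetric]) auto
  also have "\<dots> = (\<Sum>n\<le>k. \<Sum>a\<le>n. (k choose (k - n)) * (n choose a) *
        ((k choose (k - n + Q)) * ((k - (k - n + Q)) choose (a + P))))"
    by (rule sum.reindex_bij_witness[of _ "\<lambda>i. k - i" "\<lambda>i. k - i"]) auto
  also have "\<dots> = (\<Sum>n\<le>k. of_bool (Q \<le> n) *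
      ((k choose n) * (k choose (n - Q)) * ((2 * n - Q) choose (n + P))))"
    by (rule sum.cong[OF refl]) (rule inner, simp)
  finally show ?thesis .
qed

section \<open>Splitting by the winding number\<close>

text \<open>The multiplier \<open>s\<close> is unique since \<open>p > 0\<close>, and
  \<open>p \<ge> 1\<close> bounds its absolute value by that of \<open>m\<close>, hence by
  \<open>k\<close>. Splitting by its sign turns the existential into a finite sum that can be
  interchanged with others.\<close>

lemma of_bool_collinear:
  fixes m l :: int and p q k :: nat
  assumes "p > 0" "\<bar>m\<bar> \<le> int k"
  shows "of_bool (\<exists>s. m = s * int p \<and> l = s * int q) =
    (of_bool (m = 0 \<and> l = 0) :: nat) +
    (\<Sum>j=1..k. of_bool (m = int (j * p) \<and> l = int (j * q)) +
               of_bool (- m = int (j * p) \<and> - l = int (j * q)))"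
proof -
  have eq: "s = s'" if "s * int p = s' * int p" for s s' using that assms by simp
  show ?thesis
  proof (cases "\<exists>s. m = s * int p \<and> l = s * int q")
    case True
    then obtain s where s: "m = s * int p" "l = s * int q" by blast
    have "\<bar>s\<bar> * 1 \<le> \<bar>s\<bar> * int p" using assms(1) by (intro mult_left_mono) auto
    with assms(2) have sk: "\<bar>s\<bar> \<le> int k" by (simp add: s abs_mult)
    have 1: "m = int (j * p) \<and> l = int (j * q) \<longleftrightarrow> s = int j" for j
      using eq[of s "int j"] by (auto simp: s)
    have 2: "- m = int (j * p) \<and> - l = int (j * q) \<longleftrightarrow> - s = int j" for j
      using eq[of "- s" "int j"] by (auto simp: s simp flip: mult_minus_left)
    have 3: "m = 0 \<and> l = 0 \<longleftrightarrow> s = 0" using assms(1) by (auto simp: s)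
    have pos: "(\<Sum>j=1..k. of_bool (r = int j) :: nat) = of_bool (0 < r)" if "r \<le> int k" for r
    proof (cases "0 < r")
      case True
      have "(\<Sum>j=1..k. of_bool (r = int j) :: nat) = (\<Sum>j=1..k. if j = nat r then 1 else 0)"
        using True by (intro sum.cong) auto
      then show ?thesis using True that by (simp add: nat_le_iff)
    next
      case False
      then show ?thesis by auto
    qed
    show ?thesis
      unfolding 1 2 3 sum.distrib using True pos[of s] pos[of "- s"] sk by auto
  next
    case False
    then have 1: "\<not> (m = int (j * p) \<and> l = int (j * q))" for j by auto
    have 2: "\<not> (- m = int (j * p) \<and> - l = int (j * q))" for j
    proof
      assume "- m = int (j * p) \<and> - l = int (j * q)"
      then have "m = - int j * int p \<and> l = - int j * int q" by simp
      with False show False by blast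
    qed
    have "\<not> (m = 0 \<and> l = 0)" using 1[of 0] by simp
    with False 1 2 show ?thesis by auto
  qed
qed

lemma dual_nanotube_moment_sum:
  fixes k p q :: nat
  assumes "p > 0"
  shows "dual_nanotube_moment p q k =
    of_nat ((\<Sum>n\<le>k. (k choose n)\<^sup>2 * ((2 * (k - n)) choose (k - n))) +
      2 * (\<Sum>j=1..k. \<Sum>n\<le>k. of_bool (j * q \<le> n) *
        ((k choose n) * (k choose (n - j * q)) * ((2 * n - j * q) choose (n + j * p)))))"
proof -
  define A where "A = (SIGMA b:{..k}. {..k - b})"
  define W where "W = (\<lambda>(b, a). (k choose b) * ((k - b) choose a))"
  define N where "N = (\<lambda>P Q. \<Sum>n\<le>k. of_bool (Q \<le> n) *
    ((k choose n) * (k choose (n - Q)) * ((2 * n - Q) choose (n + P))))"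
  have finA: "finite A" by (simp add: A_def)
  have corr: "(\<Sum>t\<in>A. \<Sum>t'\<in>A. W t * W t' *
      of_bool (int (snd t') - int (snd t) = int P \<and> int (fst t') - int (fst t) = int Q)) = N P Q" for P Q
  proof -
    have "(\<Sum>t'\<in>A. W t * W t' *
        of_bool (int (snd t') - int (snd t) = int P \<and> int (fst t') - int (fst t) = int Q)) =
      W t * W (fst t + Q, snd t + P)" for t
    proof -
      have "(\<Sum>t'\<in>A. W t * W t' *
        of_bool (int (snd t') - int (snd t) = int P \<and> int (fst t') - int (fst t) = int Q)) =
        (\<Sum>t'\<in>A. if t' = (fst t + Q, snd t + P) then W t * W t' else 0)"
        by (intro sum.cong) (auto simp: prod_eq_iff)
      also have "\<dots> = (if (fst t + Q, snd t + P) \<in> A then W t * W (fst t + Q, snd t + P) else 0)"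
        using finA by simp
      \<comment> \<open>When the translate leaves \<open>A\<close>, one of the binomials in its
        weight is already 0.\<close>
      also have "\<dots> = W t * W (fst t + Q, snd t + P)"
        by (auto simp: A_def W_def binomial_eq_0)
      finally show ?thesis .
    qed
    then show ?thesis
      using trinomial_correlation[of k Q P] by (simp add: A_def W_def N_def case_prod_unfold)
  qed
  \<comment> \<open>Negating the difference amounts to exchanging \<open>t\<close> and
    \<open>t'\<close>, so opposite winding numbers contribute equally.\<close>
  have corr': "(\<Sum>t\<in>A. \<Sum>t'\<in>A. W t * W t' *
      of_bool (- (int (snd t') - int (snd t)) = int P \<and> - (int (fst t') - int (fst t)) = int Q)) = N P Q" for P Q
    unfolding corr[symmetric] by (subst sum.swap) (simp add: mult_ac)
  have "(\<Sum>t\<in>A. \<Sum>t'\<in>A. W t * W t' *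
       of_bool (\<exists>s. int (snd t') - int (snd t) = s * int p \<and> int (fst t') - int (fst t) = s * int q)) =
    (\<Sum>t\<in>A. \<Sum>t'\<in>A. W t * W t' *
       (of_bool (int (snd t') - int (snd t) = int 0 \<and> int (fst t') - int (fst t) = int 0) +
        (\<Sum>j=1..k. of_bool (int (snd t') - int (snd t) = int (j * p) \<and> int (fst t') - int (fst t) = int (j * q)) +
          of_bool (- (int (snd t') - int (snd t)) = int (j * p) \<and> - (int (fst t') - int (fst t)) = int (j * q)))))"
    \<comment> \<open>Exponents in \<open>A\<close> lie between 0 and \<open>k\<close>, which bounds
      their differences as required.\<close>
    using assms by (intro sum.cong refl, subst of_bool_collinear[where k = k]) (auto simp: A_def)
  also have "\<dots> = N 0 0 + (\<Sum>j=1..k. N (j * p) (j * q) + N (j * p) (j * q))"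
    unfolding distrib_left sum.distrib sum_distrib_left corr
    by (simp only: sum.swap[where A = A and B = "{1..k}"] corr corr')
  \<comment> \<open>Only the unshifted term is reflected, to match the weights in
    \<open>sum_trinomial_squared\<close>; the shifted terms keep their \<open>n\<close>, which
    becomes \<open>k1\<close>.\<close>
  also have "N 0 0 = (\<Sum>n\<le>k. (k choose n)\<^sup>2 * ((2 * (k - n)) choose (k - n)))"
    unfolding N_def
    by (rule sum.reindex_bij_witness[of _ "\<lambda>i. k - i" "\<lambda>i. k - i"])
       (auto simp: power2_eq_square binomial_symmetric[symmetric])
  finally show ?thesis
    unfolding dual_nanotube_moment_pairs[OF assms] A_def[symmetric] W_def[symmetric] N_def
    by (simp add: sum.cartesian_product[symmetric] sum.distrib)
qed

section \<open>Matching the sum over trinomial coefficients\<close>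

lemma trinomial_eq_binomial:
  assumes "k1 + k2 + k3 = k"
  shows "trinomial k k1 k2 k3 = real (k choose k1) * real ((k - k1) choose k2)"
proof -
  from assms have "k1 \<le> k" "k2 \<le> k - k1" "k - k1 - k2 = k3" by auto
  then show ?thesis
    by (simp add: trinomial_def binomial_fact)
qed

text \<open>As \<open>g\<close> depends on \<open>k1\<close> alone, the inner sum is one of squared
  binomials, equal to a central binomial coefficient.\<close>

lemma sum_trinomial_squared:
  fixes g :: "nat \<Rightarrow> real"
  shows "(\<Sum>(k1, k2, k3) \<in> {(k1, k2, k3). k1 + k2 + k3 = k}. (trinomial k k1 k2 k3)\<^sup>2 * g k1) =
    (\<Sum>n\<le>k. real ((k choose n)\<^sup>2 * ((2 * (k - n)) choose (k - n))) * g n)"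
proof -
  have "(\<Sum>(k1, k2, k3) \<in> {(k1, k2, k3). k1 + k2 + k3 = k}. (trinomial k k1 k2 k3)\<^sup>2 * g k1) =
    (\<Sum>(n, i)\<in>(SIGMA n:{..k}. {..k - n}). (real (k choose n) * real ((k - n) choose i))\<^sup>2 * g n)"
    by (rule sum.reindex_bij_witness[of _ "\<lambda>(n, i). (n, i, k - n - i)" "\<lambda>(k1, k2, k3). (k1, k2)"])
       (auto simp: trinomial_eq_binomial)
  also have "\<dots> = (\<Sum>n\<le>k. \<Sum>i\<le>k - n. (real (k choose n) * real ((k - n) choose i))\<^sup>2 * g n)"
    by (rule sum.Sigma[symmetric]) auto
  also have "\<dots> = (\<Sum>n\<le>k. real ((k choose n)\<^sup>2 * ((2 * (k - n)) choose (k - n))) * g n)"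
    by (simp add: choose_square_sum[symmetric] power_mult_distrib sum_distrib_left sum_distrib_right)
  finally show ?thesis .
qed

theorem proposition6:
  fixes p q k :: nat and M :: "'a measure" and X :: "'a \<Rightarrow> real"
  assumes "p + q \<ge> 5" and "q \<le> p"
    and "random_eigenvalue_dual_nanotube M p q X"
    and "k \<ge> 1"
  shows "prob_space.expectation M (\<lambda>\<omega>. X \<omega> ^ k) =
    (\<Sum>(k1, k2, k3) \<in> {(k1, k2, k3). k1 + k2 + k3 = k}.
       (trinomial k k1 k2 k3)\<^sup>2 *
       (1 + 2 * (\<Sum>j = 1..nat \<lfloor>real k1 / real (p + q)\<rfloor>.
          real ((2 * k1 - j * q) choose (k1 + j * p)) * real (k choose (k1 - j * q)) /
          (real (k choose k1) * real ((2 * (k - k1)) choose (k - k1))))))"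
proof -
  from assms have p: "p > 0" by linarith
  define B where "B = (\<lambda>n j. (k choose n) * (k choose (n - j * q)) * ((2 * n - j * q) choose (n + j * p)))"
  \<comment> \<open>Up to the quotient, \<open>j * q \<le> n\<close> is automatic. Beyond it
    \<open>n < j * (p + q)\<close>, so either the guard fails or
    \<open>2 * n - j * q < n + j * p\<close> and the last binomial vanishes.\<close>
  have range: "(\<Sum>j=1..n div (p + q). B n j) = (\<Sum>j=1..k. of_bool (j * q \<le> n) * B n j)"
    if n: "n \<le> k" for n
  proof (rule sum.mono_neutral_cong_left)
    show "{1..n div (p + q)} \<subseteq> {1..k}"
      using order_trans[OF div_le_dividend n] by auto
  next
    show "\<forall>j\<in>{1..k} - {1..n div (p + q)}. of_bool (j * q \<le> n) * B n j = 0"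
    proof
      fix j assume "j \<in> {1..k} - {1..n div (p + q)}"
      then have "n < j * (p + q)"
        using p by (auto simp: less_eq_div_iff_mult_less_eq not_le)
      then have "2 * n - j * q < n + j * p \<or> \<not> j * q \<le> n"
        by (auto simp: algebra_simps)
      then show "of_bool (j * q \<le> n) * B n j = 0"
        by (auto simp: B_def binomial_eq_0)
    qed
  next
    fix j assume "j \<in> {1..n div (p + q)}"
    then have "j * (p + q) \<le> n"
      using p by (auto simp: less_eq_div_iff_mult_less_eq)
    then show "B n j = of_bool (j * q \<le> n) * B n j" by (simp add: algebra_simps)
  qed simp
  \<comment> \<open>The weight obtained from the squared trinomials contains the denominator as a
    factor, leaving one \<open>k choose n\<close>, as in \<open>B\<close>.\<close>
  have summand: "real ((k choose n)\<^sup>2 * ((2 * (k - n)) choose (k - n))) *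
      (1 + 2 * (\<Sum>j = 1..nat \<lfloor>real n / real (p + q)\<rfloor>.
          real ((2 * n - j * q) choose (n + j * p)) * real (k choose (n - j * q)) /
          (real (k choose n) * real ((2 * (k - n)) choose (k - n))))) =
    real ((k choose n)\<^sup>2 * ((2 * (k - n)) choose (k - n)) +
       2 * (\<Sum>j=1..k. of_bool (j * q \<le> n) * B n j))"
    if n: "n \<le> k" for n
  proof -
    define c where "c = real (k choose n)"
    define d where "d = real ((2 * (k - n)) choose (k - n))"
    have cd: "c \<noteq> 0" "d \<noteq> 0" using n by (auto simp: c_def d_def)
    have floor: "nat \<lfloor>real n / real (p + q)\<rfloor> = n div (p + q)"
      by (simp only: floor_divide_of_nat_eq nat_int)
    have B: "c\<^sup>2 * d * (real ((2 * n - j * q) choose (n + j * p)) * real (k choose (n - j * q)) / (c * d)) =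
        real (B n j)" for j
      using cd by (simp add: B_def c_def[symmetric] power2_eq_square)
    have "c\<^sup>2 * d * (1 + 2 * (\<Sum>j = 1..n div (p + q).
          real ((2 * n - j * q) choose (n + j * p)) * real (k choose (n - j * q)) / (c * d))) =
        c\<^sup>2 * d + 2 * (\<Sum>j = 1..n div (p + q). real (B n j))"
      unfolding B[symmetric] sum_distrib_left[symmetric] by (simp only: distrib_left mult_1_right mult.left_commute)
    also have "(\<Sum>j = 1..n div (p + q). real (B n j)) = real (\<Sum>j=1..k. of_bool (j * q \<le> n) * B n j)"
      unfolding range[OF n, symmetric] by simp
    finally show ?thesis
      unfolding floor by (simp only: c_def d_def of_nat_mult of_nat_power of_nat_add of_nat_numeral)
  qed
  have "complex_of_real (prob_space.expectation M (\<lambda>\<omega>. X \<omega> ^ k)) = dual_nanotube_moment p q k"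
    using assms(3) by (simp add: random_eigenvalue_dual_nanotube_def)
  also have "\<dots> = complex_of_real (real (\<Sum>n\<le>k. (k choose n)\<^sup>2 * ((2 * (k - n)) choose (k - n)) +
      2 * (\<Sum>j=1..k. of_bool (j * q \<le> n) * B n j)))"
    unfolding dual_nanotube_moment_sum[OF p] B_def sum.distrib sum_distrib_left[symmetric]
    by (subst sum.swap) simp
  finally have "prob_space.expectation M (\<lambda>\<omega>. X \<omega> ^ k) =
    real (\<Sum>n\<le>k. (k choose n)\<^sup>2 * ((2 * (k - n)) choose (k - n)) +
      2 * (\<Sum>j=1..k. of_bool (j * q \<le> n) * B n j))"
    unfolding of_real_eq_iff .
  then show ?thesis
    unfolding sum_trinomial_squared of_nat_sum[where A = "{..k}"]
    by (simp only:) (intro sum.cong refl summand[symmetric], simp)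
qed

end
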